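(* Let $X$ be a $1$-homogeneous metric space with $n:=|X|$ elements. If $n=2k+1$ for an integer $k\ge0$, then $\delta(X)\le k+1$. Hence, $\Delta_1(n)=\Delta_2(n)=\beta_n$ for every odd $n\ge 1$, where $\beta_n=k+1$ for $n=2k+1$.
   Context: A metric space $X$ is $j$-homogeneous if every bijective isometry $f\colon A\to B$ between subspaces $A,B\subseteq X$ with $|A|\le j$ extends to a bijective isometry $X\to X$. Let $\delta(X)$ be the number of distinct values $d(x,y)$, $x,y\in X$ (including the value $0$). For $j,n\ge1$, $\Delta_j(n)$ is the maximum of $\delta(X)$ over all $j$-homogeneous metric spaces $X$ with $|X|=n$. In general $\beta_n:=2^m(k+1)$ for $n=2^m(2k+1)$. *)

theory Defs
  imports "HOL-Analysis.Abstract_Metric_Spaces"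
begin

definition bij_isometry :: "('a \<Rightarrow> 'a \<Rightarrow> real) \<Rightarrow> 'a set \<Rightarrow> 'a set \<Rightarrow> ('a \<Rightarrow> 'a) \<Rightarrow> bool" where
  "bij_isometry d A B f \<longleftrightarrow> bij_betw f A B \<and> (\<forall>x\<in>A. \<forall>y\<in>A. d (f x) (f y) = d x y)"

definition homogeneous :: "nat \<Rightarrow> 'a set \<Rightarrow> ('a \<Rightarrow> 'a \<Rightarrow> real) \<Rightarrow> bool" where
  "homogeneous j X d \<longleftrightarrow>
     (\<forall>A B f. A \<subseteq> X \<and> B \<subseteq> X \<and> finite A \<and> card A \<le> j \<and> bij_isometry d A B f \<longrightarrow>
        (\<exists>g. bij_isometry d X X g \<and> (\<forall>x\<in>A. g x = f x)))"

definition num_dist :: "'a set \<Rightarrow> ('a \<Rightarrow> 'a \<Rightarrow> real) \<Rightarrow> nat" where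
  "num_dist X d = card {d x y | x y. x \<in> X \<and> y \<in> X}"

text \<open>The \<open>n\<close>-point spaces are taken with carriers in \<^typ>\<open>nat\<close>. This is no restriction, as a space
  with any other carrier can be transported along a bijection; see \<open>num_dist_le_Delta\<close> below.\<close>

definition num_dist_values :: "nat \<Rightarrow> nat \<Rightarrow> nat set" where
  "num_dist_values j n =
     {num_dist X d | (X :: nat set) d.
        Metric_space X d \<and> finite X \<and> card X = n \<and> homogeneous j X d}"

definition Delta :: "nat \<Rightarrow> nat \<Rightarrow> nat" where
  "Delta j n = Max (num_dist_values j n)"

definition beta :: "nat \<Rightarrow> nat" where
  "beta n = (THE b. \<exists>m k. n = 2 ^ m * (2 * k + 1) \<and> b = 2 ^ m * (k + 1))"

lemma beta_eq: "beta (2 ^ m * (2 * k + 1)) = 2 ^ m * (k + 1)"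
proof -
  have uniq: "m = m' \<and> k = k'"
    if "(2::nat) ^ m * (2 * k + 1) = 2 ^ m' * (2 * k' + 1)" for m k m' k'
    using that
  proof (induction m arbitrary: m')
    case 0
    then have eq: "2 * k + 1 = 2 ^ m' * (2 * k' + 1)" by simp
    have "odd (2 * k + 1)" by simp
    then have "odd ((2::nat) ^ m')" unfolding eq even_mult_iff by blast
    then have "m' = 0" by simp
    then show ?case using eq by simp
  next
    case (Suc m)
    show ?case
    proof (cases m')
      case 0
      then have eq: "2 ^ Suc m * (2 * k + 1) = 2 * k' + 1" using Suc.prems by simp
      have "even (2 ^ Suc m * (2 * k + 1))" by simp
      then show ?thesis unfolding eq by simp
    next
      case l: (Suc l)
      have "2 * (2 ^ m * (2 * k + 1)) = 2 * (2 ^ l * (2 * k' + 1))"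
        using Suc.prems l by (simp only: power_Suc mult.assoc)
      then have "2 ^ m * (2 * k + 1) = 2 ^ l * (2 * k' + 1)" by linarith
      then show ?thesis using Suc.IH l by blast
    qed
  qed
  show ?thesis unfolding beta_def
  proof (rule the_equality)
    show "\<exists>m' k'. 2 ^ m * (2 * k + 1) = 2 ^ m' * (2 * k' + 1) \<and> 2 ^ m * (k + 1) = 2 ^ m' * (k' + 1)"
      by blast
  next
    fix b
    assume "\<exists>m' k'. 2 ^ m * (2 * k + 1) = 2 ^ m' * (2 * k' + 1) \<and> b = 2 ^ m' * (k' + 1)"
    then obtain m' k' where *: "2 ^ m * (2 * k + 1) = 2 ^ m' * (2 * k' + 1)" "b = 2 ^ m' * (k' + 1)"
      by blast
    show "b = 2 ^ m * (k + 1)" using uniq[OF *(1)] *(2) by simp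
  qed
qed

lemma num_dist_le: "finite X \<Longrightarrow> num_dist X d \<le> card X * card X"
proof -
  assume "finite X"
  then have "finite (X \<times> X)" by simp
  then have "card ((\<lambda>(x, y). d x y) ` (X \<times> X)) \<le> card (X \<times> X)" by (rule card_image_le)
  moreover have "{d x y | x y. x \<in> X \<and> y \<in> X} = (\<lambda>(x, y). d x y) ` (X \<times> X)" by auto
  ultimately show ?thesis by (simp add: num_dist_def card_cartesian_product)
qed

lemma finite_num_dist_values: "finite (num_dist_values j n)"
  by (rule finite_subset[of _ "{..n * n}"]) (use num_dist_le in \<open>auto simp: num_dist_values_def\<close>)

lemma num_dist_values_nonempty: "num_dist_values j n \<noteq> {}"
proof -
  define d :: "nat \<Rightarrow> nat \<Rightarrow> real" where "d = (\<lambda>x y. if x = y then 0 else 1)"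
  have "Metric_space {..<n} d" by unfold_locales (auto simp: d_def)
  moreover have "homogeneous j {..<n} d" unfolding homogeneous_def
  proof (intro allI impI, elim conjE)
    fix A B f
    assume A: "A \<subseteq> {..<n}" and B: "B \<subseteq> {..<n}" and "finite A" and f: "bij_isometry d A B f"
    have bf: "bij_betw f A B" using f by (simp add: bij_isometry_def)
    have fin: "finite A" "finite B" using A B finite_subset by blast+
    have "card ({..<n} - A) = card ({..<n} - B)"
      using A B fin bij_betw_same_card[OF bf] by (simp add: card_Diff_subset)
    then obtain h where h: "bij_betw h ({..<n} - A) ({..<n} - B)"
      using finite_same_card_bij by blast
    define g where "g = (\<lambda>x. if x \<in> A then f x else h x)"
    have "bij_betw g A B" using bf by (simp add: g_def cong: bij_betw_cong)
    moreover have "bij_betw g ({..<n} - A) ({..<n} - B)"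
      using h by (subst bij_betw_cong[of _ _ h]) (auto simp: g_def)
    ultimately have "bij_betw g (A \<union> ({..<n} - A)) (B \<union> ({..<n} - B))"
      by (rule bij_betw_combine) auto
    then have bg: "bij_betw g {..<n} {..<n}" using A B by (simp add: Un_absorb1)
    then have "bij_isometry d {..<n} {..<n} g"
      by (auto simp: bij_isometry_def d_def bij_betw_def inj_on_def)
    then show "\<exists>g. bij_isometry d {..<n} {..<n} g \<and> (\<forall>x\<in>A. g x = f x)"
      by (auto simp: g_def)
  qed
  ultimately show ?thesis unfolding num_dist_values_def
    by (auto intro!: exI[of _ "{..<n}"] exI[of _ d])
qed

lemma homogeneous_transport:
  assumes h: "bij_betw h Y X" and hom: "homogeneous j X d"
  shows "homogeneous j Y (\<lambda>x y. d (h x) (h y))"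
  unfolding homogeneous_def
proof (intro allI impI, elim conjE)
  fix A B f
  assume A: "A \<subseteq> Y" and B: "B \<subseteq> Y" and "finite A" "card A \<le> j"
    and f: "bij_isometry (\<lambda>x y. d (h x) (h y)) A B f"
  define i where "i = inv_into Y h"
  have i: "bij_betw i X Y" using h by (simp add: i_def bij_betw_inv_into)
  have ih: "i (h y) = y" if "y \<in> Y" for y
    using that h by (simp add: i_def bij_betw_inv_into_left)
  have hi: "h (i x) = x" if "x \<in> X" for x
    using that h by (simp add: i_def bij_betw_inv_into_right)
  have bf: "bij_betw f A B" using f by (simp add: bij_isometry_def)
  have hA: "bij_betw h A (h ` A)" "bij_betw h B (h ` B)"
    using h A B by (meson bij_betw_subset)+
  have "bij_betw i (h ` A) A"
    by (rule bij_betw_byWitness[where f' = h]) (use A ih in auto)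
  then have "bij_betw (h \<circ> f \<circ> i) (h ` A) (h ` B)"
    using bf hA(2) by (meson bij_betw_trans)
  moreover have "d (h (f (i x))) (h (f (i y))) = d x y" if "x \<in> h ` A" "y \<in> h ` A" for x y
    using that f A ih by (auto simp: bij_isometry_def subset_iff)
  ultimately have "bij_isometry d (h ` A) (h ` B) (h \<circ> f \<circ> i)"
    by (simp add: bij_isometry_def)
  moreover have "h ` A \<subseteq> X" "h ` B \<subseteq> X" using A B h by (auto simp: bij_betw_def)
  moreover have "finite (h ` A)" "card (h ` A) \<le> j"
    using \<open>finite A\<close> \<open>card A \<le> j\<close> card_image_le[of A h] by auto
  ultimately obtain g where g: "bij_isometry d X X g" "\<forall>x\<in>h ` A. g x = h (f (i x))"
    using hom unfolding homogeneous_def by (metis comp_apply)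
  have gX: "g x \<in> X" if "x \<in> X" for x
    using that g(1) by (auto simp: bij_isometry_def bij_betw_def)
  have hY: "h y \<in> X" if "y \<in> Y" for y using that h by (auto simp: bij_betw_def)
  have "bij_betw (i \<circ> g \<circ> h) Y Y"
    using h g(1) i unfolding bij_isometry_def by (meson bij_betw_trans)
  then have "bij_isometry (\<lambda>x y. d (h x) (h y)) Y Y (i \<circ> g \<circ> h)"
    using g(1) hi gX hY by (simp add: bij_isometry_def)
  moreover have "(i \<circ> g \<circ> h) x = f x" if "x \<in> A" for x
    using that g(2) A B ih bf by (auto simp: bij_betw_def subset_iff)
  ultimately show "\<exists>g. bij_isometry (\<lambda>x y. d (h x) (h y)) Y Y g \<and> (\<forall>x\<in>A. g x = f x)"
    by blast
qed

lemma num_dist_le_Delta: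
  fixes X :: "'a set"
  assumes X: "Metric_space X d" and fin: "finite X" and hom: "homogeneous j X d"
  shows "num_dist X d \<le> Delta j (card X)"
proof -
  define Y where "Y = {..<card X}"
  obtain h where h: "bij_betw h Y X"
    using fin finite_same_card_bij[of Y X] by (auto simp: Y_def)
  define e where "e = (\<lambda>x y. d (h x) (h y))"
  interpret Metric_space X d by (rule X)
  have hX: "h ` Y = X" "inj_on h Y" using h by (auto simp: bij_betw_def)
  have "Metric_space Y e"
  proof
    fix x y z
    show "0 \<le> e x y" "e x y = e y x" by (simp_all add: e_def commute)
    assume "x \<in> Y" "y \<in> Y"
    then show "e x y = 0 \<longleftrightarrow> x = y" using hX by (auto simp: e_def inj_on_eq_iff)
    assume "z \<in> Y"
    with \<open>x \<in> Y\<close> \<open>y \<in> Y\<close> show "e x z \<le> e x y + e y z"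
      using hX(1) unfolding e_def by (intro triangle) auto
  qed
  moreover have "homogeneous j Y e"
    unfolding e_def by (rule homogeneous_transport[OF h hom])
  moreover have "num_dist Y e = num_dist X d"
  proof -
    have "{e x y | x y. x \<in> Y \<and> y \<in> Y} = {d x y | x y. x \<in> X \<and> y \<in> X}"
      unfolding hX(1)[symmetric] e_def by blast
    then show ?thesis by (simp add: num_dist_def)
  qed
  ultimately have "num_dist X d \<in> num_dist_values j (card X)"
    unfolding num_dist_values_def by (auto simp: Y_def intro!: exI[of _ "{..<card X}"] exI[of _ e])
  then show ?thesis
    unfolding Delta_def using finite_num_dist_values by simp
qed

end

theory Submission
  imports Defs
begin

text \<open>
  The upper bound is a parity argument. In a 1-homogeneous space any point can be moved to any
  other, so the number \<open>s r\<close> of points at distance \<open>r\<close> from a given point does not depend on that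
  point, and every distance of the space already occurs from any fixed point. Counting ordered
  pairs at distance \<open>r\<close> gives \<open>n * s r\<close>. For \<open>r \<noteq> 0\<close> these pairs form a symmetric irreflexive
  relation, so their number is even; as \<open>n\<close> is odd, \<open>s r\<close> is even. Every nonempty sphere of
  nonzero radius around a point thus has at least two elements, and since these spheres partition
  the \<open>2k\<close> other points, there are at most \<open>k\<close> nonzero distances
  (\<open>num_dist_le_of_homogeneous_1\<close>).

  The bound is attained by the cycle of length \<open>2k+1\<close> with its path metric. It realises the
  distances \<open>0, \<dots>, k\<close>, and it is even 2-homogeneous: two pairs at the same distance have equal or
  opposite differences modulo \<open>n\<close>, so a rotation or a reflection maps one to the other
  (\<open>homogeneous_2_cycle\<close>). As 2-homogeneity implies 1-homogeneity,
  \<open>k + 1 \<le> Delta 2 n \<le> Delta 1 n \<le> k + 1\<close>.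
\<close>

section \<open>Homogeneity and the upper bound for odd order\<close>

lemma homogeneous_mono:
  assumes "homogeneous j X d" "i \<le> j"
  shows "homogeneous i X d"
  using assms unfolding homogeneous_def by (meson le_trans)

text \<open>Pairs \<open>(a, b)\<close> and \<open>(b, a)\<close> of the relation are distinct, and are removed together.\<close>

lemma even_card_sym_irrefl:
  assumes "finite R" "sym R" "irrefl R"
  shows "even (card R)"
  using assms
proof (induction "card R" arbitrary: R rule: less_induct)
  case less
  show ?case
  proof (cases "R = {}")
    case False
    then obtain a b where ab: "(a, b) \<in> R" by auto
    then have ba: "(b, a) \<in> R" and "a \<noteq> b"
      using less.prems by (auto dest: symD simp: irrefl_def)
    define S where "S = R - {(a, b), (b, a)}"
    have R: "R = insert (a, b) (insert (b, a) S)" using ab ba by (auto simp: S_def)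
    have "finite S" using less.prems by (simp add: S_def)
    then have card: "card R = Suc (Suc (card S))"
      unfolding R using \<open>a \<noteq> b\<close> by (simp add: S_def)
    moreover have "sym S" "irrefl S"
      using less.prems by (auto simp: S_def sym_def irrefl_def)
    ultimately show ?thesis using less.hyps[of S] \<open>finite S\<close> by simp
  qed simp
qed

lemma homogeneous_1_transitive:
  assumes "Metric_space X d" "homogeneous 1 X d" "x \<in> X" "y \<in> X"
  obtains g where "bij_isometry d X X g" "g x = y"
proof -
  interpret Metric_space X d by fact
  have "bij_isometry d {x} {y} (\<lambda>_. y)"
    using assms(3,4) by (simp add: bij_isometry_def bij_betw_def)
  then have "\<exists>g. bij_isometry d X X g \<and> (\<forall>z\<in>{x}. g z = y)"
    using assms(2-4) unfolding homogeneous_def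
    by (elim allE[of _ "{x}"] allE[of _ "{y}"] allE[of _ "\<lambda>_. y"]) simp
  then show ?thesis using that by blast
qed

lemma card_sphere_eq:
  assumes "Metric_space X d" "homogeneous 1 X d" "x \<in> X" "y \<in> X"
  shows "card {z \<in> X. d x z = r} = card {z \<in> X. d y z = r}"
proof -
  obtain g where g: "bij_isometry d X X g" "g x = y"
    using homogeneous_1_transitive[OF assms] .
  then have inj: "inj_on g X" and im: "g ` X = X"
    and iso: "\<And>z. z \<in> X \<Longrightarrow> d y (g z) = d x z"
    using assms(3) by (auto simp: bij_isometry_def bij_betw_def)
  have "g ` {z \<in> X. d x z = r} = {z \<in> X. d y z = r}"
    using im iso by force
  then show ?thesis
    using inj by (metis (no_types, lifting) card_image inj_on_subset mem_Collect_eq subsetI)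
qed

text \<open>The \<open>n * s\<close> ordered pairs at distance \<open>r\<close> come in twos, whereas \<open>n\<close> is odd.\<close>

lemma even_card_sphere:
  assumes "Metric_space X d" "homogeneous 1 X d" "odd (card X)" "x \<in> X" "r \<noteq> 0"
  shows "even (card {z \<in> X. d x z = r})"
proof -
  interpret Metric_space X d by fact
  have fin: "finite X" using assms(3) by (cases "finite X") auto
  define R where "R = (SIGMA u:X. {z \<in> X. d u z = r})"
  have "finite R" using fin by (simp add: R_def)
  moreover have "sym R" by (auto simp: R_def sym_def commute)
  moreover have "irrefl R" using assms(5) by (auto simp: R_def irrefl_def)
  ultimately have "even (card R)" by (rule even_card_sym_irrefl)
  moreover have "card R = card X * card {z \<in> X. d x z = r}"
  proof -
    have "card R = (\<Sum>u\<in>X. card {z \<in> X. d u z = r})"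
      using fin by (simp add: R_def)
    also have "\<dots> = (\<Sum>u\<in>X. card {z \<in> X. d x z = r})"
      using card_sphere_eq[OF assms(1,2) _ assms(4)] by (intro sum.cong) auto
    finally show ?thesis by simp
  qed
  ultimately show ?thesis using assms(3) by simp
qed

lemma card_image_times_le:
  assumes "finite S" "\<And>y. y \<in> f ` S \<Longrightarrow> m \<le> card {x \<in> S. f x = y}"
  shows "m * card (f ` S) \<le> card S"
proof -
  have "m * card (f ` S) \<le> (\<Sum>y\<in>f ` S. card {x \<in> S. f x = y})"
    using sum_mono[of "f ` S" "\<lambda>_. m"] assms(2) by (simp add: mult.commute)
  also have "\<dots> = card S"
    using sum.image_gen[OF assms(1), of "\<lambda>_. 1::nat" f] by simp
  finally show ?thesis .
qed

text \<open>Fix a point \<open>x\<close>. All distances occur from \<open>x\<close>, and each nonzero one is attained at least twice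
  among the other \<open>2k\<close> points, because spheres of nonzero radius have even size.\<close>

lemma num_dist_le_of_homogeneous_1:
  assumes "Metric_space X d" "homogeneous 1 X d" "card X = 2 * k + 1"
  shows "num_dist X d \<le> k + 1"
proof -
  interpret Metric_space X d by fact
  have fin: "finite X" using assms(3) card.infinite by fastforce
  obtain x where x: "x \<in> X" using assms(3) by fastforce
  define D where "D = d x ` (X - {x})"
  have "2 * card D \<le> card (X - {x})" unfolding D_def
  proof (rule card_image_times_le)
    fix r assume "r \<in> d x ` (X - {x})"
    then obtain y where y: "y \<in> X" "y \<noteq> x" "r = d x y" by auto
    then have "r \<noteq> 0" using x by simp
    then have sphere: "{z \<in> X - {x}. d x z = r} = {z \<in> X. d x z = r}" using x by auto
    have "even (card {z \<in> X. d x z = r})"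
      using even_card_sphere[OF assms(1,2) _ x \<open>r \<noteq> 0\<close>] assms(3) by simp
    moreover have "card {z \<in> X. d x z = r} \<noteq> 0" using y fin by auto
    ultimately show "2 \<le> card {z \<in> X - {x}. d x z = r}"
      unfolding sphere by presburger
  qed (use fin in simp)
  also have "\<dots> = 2 * k" using x fin assms(3) by simp
  finally have "card D \<le> k" by simp
  have "{d u v | u v. u \<in> X \<and> v \<in> X} \<subseteq> insert 0 D"
  proof clarify
    fix u v assume uv: "u \<in> X" "v \<in> X" "d u v \<notin> D"
    obtain g where g: "bij_isometry d X X g" "g u = x"
      using homogeneous_1_transitive[OF assms(1,2) uv(1) x] .
    then have "d u v = d x (g v)" "g v \<in> X"
      using uv by (auto simp: bij_isometry_def bij_betw_def)
    then show "d u v = 0" using uv(3) x by (auto simp: D_def)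
  qed
  then have "num_dist X d \<le> card (insert 0 D)"
    unfolding num_dist_def using fin by (intro card_mono) (auto simp: D_def)
  also have "\<dots> \<le> k + 1"
    using \<open>card D \<le> k\<close> fin by (simp add: D_def card_insert_if)
  finally show ?thesis .
qed

section \<open>The odd cycle\<close>

text \<open>Path metric of the cycle on the residues modulo \<open>n\<close>. Writing it with both residues of the
  difference makes its invariance under rotations and reflections a matter of arithmetic modulo
  \<open>n\<close>.\<close>

definition cycle_dist :: "int \<Rightarrow> int \<Rightarrow> int \<Rightarrow> real" where
  "cycle_dist n x y = of_int (min ((x - y) mod n) ((y - x) mod n))"

lemma diff_mod_eq:
  fixes x y n :: int
  assumes "x \<in> {0..<n}" "y \<in> {0..<n}"
  shows "(x - y) mod n = (if y \<le> x then x - y else x - y + n)"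
proof (cases "y \<le> x")
  case False
  then have "(x - y + n) mod n = x - y + n"
    using assms by (intro mod_pos_pos_trivial) auto
  then show ?thesis using False by simp
qed (use assms in \<open>auto intro: mod_pos_pos_trivial\<close>)

lemma Metric_space_cycle:
  assumes "n > 0"
  shows "Metric_space {0..<n} (cycle_dist n)"
proof
  fix x y z :: int
  show "0 \<le> cycle_dist n x y"
    using assms by (simp add: cycle_dist_def)
  show "cycle_dist n x y = cycle_dist n y x"
    by (simp add: cycle_dist_def min.commute)
  assume x: "x \<in> {0..<n}" and y: "y \<in> {0..<n}"
  show "cycle_dist n x y = 0 \<longleftrightarrow> x = y"
    using x y by (auto simp: cycle_dist_def diff_mod_eq min_def)
  assume z: "z \<in> {0..<n}"
  have "min ((x - z) mod n) ((z - x) mod n)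
      \<le> min ((x - y) mod n) ((y - x) mod n) + min ((y - z) mod n) ((z - y) mod n)"
    using x y z by (simp add: diff_mod_eq min_def)
  then show "cycle_dist n x z \<le> cycle_dist n x y + cycle_dist n y z"
    unfolding cycle_dist_def by linarith
qed

lemma bij_isometry_finite_self:
  assumes "Metric_space X d" "finite X" "g ` X \<subseteq> X"
    and iso: "\<And>x y. x \<in> X \<Longrightarrow> y \<in> X \<Longrightarrow> d (g x) (g y) = d x y"
  shows "bij_isometry d X X g"
proof -
  interpret Metric_space X d by fact
  have "inj_on g X"
  proof (rule inj_onI)
    fix x y assume xy: "x \<in> X" "y \<in> X" "g x = g y"
    then have "d x y = d (g y) (g y)" using iso[of x y] by simp
    also have "\<dots> = 0" using iso[of y y] xy by simp
    finally show "x = y" using xy by simp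
  qed
  then have "bij_betw g X X"
    using assms(2,3) by (simp add: bij_betw_def endo_inj_surj)
  then show ?thesis using iso by (simp add: bij_isometry_def)
qed

text \<open>The maps \<open>z \<mapsto> a + s (z - c)\<close> with \<open>s = 1\<close> are the rotations, those with \<open>s = -1\<close> the
  reflections.\<close>

lemma bij_isometry_dihedral:
  assumes "n > 0" "s = 1 \<or> s = -1"
  shows "bij_isometry (cycle_dist n) {0..<n} {0..<n} (\<lambda>z. (a + s * (z - c)) mod n)"
proof (rule bij_isometry_finite_self[OF Metric_space_cycle])
  fix x y :: int
  have "((a + s * (x - c)) mod n - (a + s * (y - c)) mod n) mod n = (s * (x - y)) mod n" for x y
    by (simp add: mod_diff_eq algebra_simps)
  then show "cycle_dist n ((a + s * (x - c)) mod n) ((a + s * (y - c)) mod n) = cycle_dist n x y"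
    using assms(2) by (auto simp: cycle_dist_def min.commute)
qed (use assms in auto)

text \<open>Equal distance means equal or opposite difference modulo \<open>n\<close>; the two cases call for a
  rotation and a reflection.\<close>

lemma cycle_two_point_extension:
  assumes "n > 0" "x' \<in> {0..<n}" "y' \<in> {0..<n}"
    and "cycle_dist n x' y' = cycle_dist n x y"
  obtains g where "bij_isometry (cycle_dist n) {0..<n} {0..<n} g" "g x = x'" "g y = y'"
proof -
  have "(y' - x') mod n = (y - x) mod n \<or> (y' - x') mod n = (x - y) mod n"
  proof -
    have neg: "(v - u) mod n = (- ((u - v) mod n)) mod n" for u v
      by (simp add: mod_minus_eq)
    have "min ((x' - y') mod n) ((y' - x') mod n) = min ((x - y) mod n) ((y - x) mod n)"
      using assms(4) by (simp add: cycle_dist_def)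
    then consider "(y' - x') mod n = (y - x) mod n" | "(y' - x') mod n = (x - y) mod n"
      | "(x' - y') mod n = (y - x) mod n" | "(x' - y') mod n = (x - y) mod n"
      by (metis min_def)
    then show ?thesis using neg by cases metis+
  qed
  then obtain s where s: "s = 1 \<or> s = -1" "(y' - x') mod n = (s * (y - x)) mod n"
    by (metis minus_diff_eq mult_1 mult_minus1)
  define g where "g = (\<lambda>z. (x' + s * (z - x)) mod n)"
  have "g x = x'" using assms(2) by (simp add: g_def)
  moreover have "g y = y'"
  proof -
    have "g y = (x' + (y' - x') mod n) mod n" by (simp add: g_def s(2) mod_add_right_eq)
    also have "\<dots> = y'" using assms(3) by (simp add: mod_add_right_eq)
    finally show ?thesis .
  qed
  moreover have "bij_isometry (cycle_dist n) {0..<n} {0..<n} g"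
    unfolding g_def by (rule bij_isometry_dihedral[OF assms(1) s(1)])
  ultimately show ?thesis using that by blast
qed

lemma homogeneous_2_cycle:
  assumes "n > 0"
  shows "homogeneous 2 {0..<n} (cycle_dist n)"
  unfolding homogeneous_def
proof (intro allI impI, elim conjE)
  fix A B f
  assume AB: "A \<subseteq> {0..<n}" "B \<subseteq> {0..<n}" and A: "finite A" "card A \<le> 2"
    and f: "bij_isometry (cycle_dist n) A B f"
  show "\<exists>g. bij_isometry (cycle_dist n) {0..<n} {0..<n} g \<and> (\<forall>z\<in>A. g z = f z)"
  proof (cases "A = {}")
    case True
    have "bij_isometry (cycle_dist n) {0..<n} {0..<n} id" by (simp add: bij_isometry_def)
    then show ?thesis using True by blast
  next
    case False
    \<comment> \<open>\<open>x = y\<close> covers the singletons.\<close>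
    then obtain x y where xy: "A = {x, y}"
    proof -
      have "card A = 1 \<or> card A = 2" using False A by (cases "card A") auto
      then show ?thesis using that by (metis card_1_singletonE card_2_iff insert_absorb2)
    qed
    have "f x \<in> {0..<n}" "f y \<in> {0..<n}"
      using f AB xy by (auto simp: bij_isometry_def bij_betw_def)
    moreover have "cycle_dist n (f x) (f y) = cycle_dist n x y"
      using f xy by (simp add: bij_isometry_def)
    ultimately obtain g where "bij_isometry (cycle_dist n) {0..<n} {0..<n} g"
      "g x = f x" "g y = f y"
      using cycle_two_point_extension[OF assms] by blast
    then show ?thesis using xy by blast
  qed
qed

text \<open>Up to halfway round the cycle, the point \<open>r\<close> has distance \<open>r\<close> from \<open>0\<close>.\<close>

lemma num_dist_odd_cycle_ge:
  "k + 1 \<le> num_dist {0..<2 * int k + 1} (cycle_dist (2 * int k + 1))"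
proof -
  let ?n = "2 * int k + 1"
  let ?D = "{cycle_dist ?n x y | x y. x \<in> {0..<?n} \<and> y \<in> {0..<?n}}"
  have dist: "cycle_dist ?n 0 r = of_int r" if "r \<in> {0..int k}" for r
    using that diff_mod_eq[of 0 ?n r] diff_mod_eq[of r ?n 0] by (auto simp: cycle_dist_def)
  have "(of_int :: int \<Rightarrow> real) ` {0..int k} \<subseteq> ?D"
  proof
    fix t :: real assume "t \<in> of_int ` {0..int k}"
    then obtain r where "r \<in> {0..int k}" "t = cycle_dist ?n 0 r" using dist by force
    then show "t \<in> ?D" by force
  qed
  moreover have "?D = (\<lambda>(x, y). cycle_dist ?n x y) ` ({0..<?n} \<times> {0..<?n})" by force
  then have "finite ?D" by simp
  ultimately have "card ((of_int :: int \<Rightarrow> real) ` {0..int k}) \<le> card ?D"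
    by (intro card_mono)
  moreover have "card ((of_int :: int \<Rightarrow> real) ` {0..int k}) = k + 1"
    by (subst card_image) (auto simp: inj_on_def)
  ultimately show ?thesis by (simp add: num_dist_def)
qed

section \<open>The maximal numbers of distances\<close>

lemma Delta_antimono:
  assumes "i \<le> j"
  shows "Delta j n \<le> Delta i n"
proof -
  have "num_dist_values j n \<subseteq> num_dist_values i n"
    unfolding num_dist_values_def using homogeneous_mono[OF _ assms] by blast
  then show ?thesis unfolding Delta_def
    by (rule Max_mono[OF _ num_dist_values_nonempty finite_num_dist_values])
qed

lemma Delta_1_odd_le: "Delta 1 (2 * k + 1) \<le> k + 1"
proof -
  have "Delta 1 (2 * k + 1) \<in> num_dist_values 1 (2 * k + 1)"
    unfolding Delta_def by (rule Max_in[OF finite_num_dist_values num_dist_values_nonempty])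
  then show ?thesis
    unfolding num_dist_values_def using num_dist_le_of_homogeneous_1 by force
qed

lemma Delta_2_odd_ge: "k + 1 \<le> Delta 2 (2 * k + 1)"
proof -
  let ?n = "2 * int k + 1"
  have "card {0..<?n} = 2 * k + 1" by simp
  then have "num_dist {0..<?n} (cycle_dist ?n) \<le> Delta 2 (2 * k + 1)"
    using num_dist_le_Delta[OF Metric_space_cycle _ homogeneous_2_cycle, of ?n] by simp
  then show ?thesis using num_dist_odd_cycle_ge[of k] by linarith
qed

lemma beta_odd: "beta (2 * k + 1) = k + 1"
  using beta_eq[of 0 k] by simp

theorem proposition6p7:
  shows "(\<forall>(X :: 'a set) d k. Metric_space X d \<and> homogeneous 1 X d \<and> card X = 2 * k + 1
              \<longrightarrow> num_dist X d \<le> k + 1)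
       \<and> (\<forall>n. odd n \<longrightarrow> Delta 1 n = Delta 2 n \<and> Delta 2 n = beta n)
       \<and> (\<forall>k. beta (2 * k + 1) = k + 1)"
proof (intro conjI allI impI)
  fix X :: "'a set" and d k
  assume "Metric_space X d \<and> homogeneous 1 X d \<and> card X = 2 * k + 1"
  then show "num_dist X d \<le> k + 1" using num_dist_le_of_homogeneous_1 by blast
next
  fix n :: nat assume "odd n"
  then obtain k where n: "n = 2 * k + 1" by (elim oddE)
  show "Delta 1 n = Delta 2 n" "Delta 2 n = beta n"
    using Delta_1_odd_le[of k] Delta_2_odd_ge[of k] Delta_antimono[of 1 2 n] beta_odd[of k]
    by (simp_all add: n)
next
  fix k show "beta (2 * k + 1) = k + 1" by (rule beta_odd)
qed

end
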